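(* For every sequence $A=(0,a_2,a_3,\dots)$ of complex numbers with $a_1=0$ and every $m\in\mathbb C$, the limit $$e_{A,m} = \lim_{x\to \infty} \frac{\#\mathcal N_{A,m}(x)}{x}$$ exists and is given by $$e_{A,m}= \frac{6}{\pi^2} \sum_{\substack{f\in\mathcal F \\ \omega_A(f) = m}} \frac{1}{f} \prod_{p\mid f} \Bigl(1+\frac{1}{p} \Bigr)^{-1}.$$ Moreover, uniformly for all such sequences $A$ and all $m\in\mathbb C$, $$\#\mathcal N_{A,m}(x) = e_{A,m}\,x+O(x^{1/2} \log x),$$ that is, there is an absolute constant $C$ such that $|\#\mathcal N_{A,m}(x)-e_{A,m}x|\leqslant Cx^{1/2}\log x$ for all real $x\geqslant2$, all such $A$ and all $m\in\mathbb C$.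
   Context: For a positive integer $n$ and $j\geqslant1$, $\omega_j(n)$ is the number of primes $p$ with $p^j\,\|\,n$ (primes dividing $n$ with multiplicity exactly $j$). For a sequence $A=(a_1,a_2,\dots)$ of complex numbers, $\omega_A(n)=\sum_{j=1}^\infty a_j\omega_j(n)$ (a finite sum for each $n$). For $m\in\mathbb C$ and real $x$, $\mathcal N_{A,m}(x)=\{n\leqslant x:\omega_A(n)=m\}$, with $n$ running over positive integers. $\mathcal F$ is the set of powerful numbers, i.e. positive integers all of whose prime factors have multiplicity at least $2$ (so $1\in\mathcal F$). The product over $p\mid f$ runs over the primes dividing $f$. *)

theory Defs
  imports "HOL-Analysis.Analysis" "HOL-Computational_Algebra.Primes"
begin

definition omega_mult :: "nat \<Rightarrow> nat \<Rightarrow> nat" where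
  "omega_mult j n = card {p. prime p \<and> multiplicity p n = j}"

(* Only the values A 1, A 2, ... are used; A 0 is irrelevant. For n > 0 only finitely
   many terms are nonzero (omega_mult_eq_0 below), so the series is a finite sum. *)
definition omega_seq :: "(nat \<Rightarrow> complex) \<Rightarrow> nat \<Rightarrow> complex" where
  "omega_seq A n = (\<Sum>\<^sub>\<infinity>j\<in>{1..}. A j * of_nat (omega_mult j n))"

definition level_set :: "(nat \<Rightarrow> complex) \<Rightarrow> complex \<Rightarrow> real \<Rightarrow> nat set" where
  "level_set A m x = {n. 0 < n \<and> real n \<le> x \<and> omega_seq A n = m}"

definition powerful :: "nat \<Rightarrow> bool" where
  "powerful n \<longleftrightarrow> 0 < n \<and> (\<forall>p\<in>prime_factors n. 2 \<le> multiplicity p n)"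

(* Lim is only meaningful if the limit exists, which has to be proved separately. *)
definition level_density :: "(nat \<Rightarrow> complex) \<Rightarrow> complex \<Rightarrow> real" where
  "level_density A m = Lim at_top (\<lambda>x::real. real (card (level_set A m x)) / x)"

lemma omega_mult_eq_0:
  assumes "0 < n" "n < j"
  shows "omega_mult j n = 0"
proof -
  have "multiplicity p n \<noteq> j" if "prime p" for p
  proof
    assume "multiplicity p n = j"
    then have "p ^ j dvd n"
      using multiplicity_dvd by metis
    then have "p ^ j \<le> n"
      using assms(1) by (simp add: dvd_imp_le)
    moreover have "j < p ^ j"
      using prime_gt_1_nat[OF that] by (simp add: power_gt_expt)
    ultimately show False
      using assms(2) by simp
  qed
  then have "{p. prime p \<and> multiplicity p n = j} = {}"
    by blast
  then show ?thesis
    unfolding omega_mult_def by (metis card.empty)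
qed

lemma omega_seq_eq_sum:
  assumes "0 < n"
  shows "omega_seq A n = (\<Sum>j=1..n. A j * of_nat (omega_mult j n))"
proof -
  have "omega_seq A n = (\<Sum>\<^sub>\<infinity>j\<in>{1..n}. A j * of_nat (omega_mult j n))"
    unfolding omega_seq_def
    by (rule infsum_cong_neutral) (auto simp: omega_mult_eq_0 assms)
  then show ?thesis
    by simp
qed

lemma finite_level_set: "finite (level_set A m x)"
proof (rule finite_subset)
  show "level_set A m x \<subseteq> {..nat \<lfloor>x\<rfloor>}"
    by (auto simp: level_set_def le_nat_floor)
qed simp

end

theory Submission
  imports Defs "HOL-Computational_Algebra.Squarefree" "HOL-Real_Asymp.Real_Asymp"
begin

text \<open>
  A positive integer \<open>n\<close> factors uniquely as \<open>f * s\<close> with \<open>f\<close> powerful, \<open>s\<close> squarefree and \<open>f\<close>,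
  \<open>s\<close> coprime. Because the coefficient of the primes of multiplicity one is zero, \<open>n\<close> and \<open>f\<close> have the
  same value of \<open>omega_seq A\<close>. A level set is therefore counted by summing, over the powerful
  \<open>f \<le> x\<close> in the level, the number of squarefree \<open>s \<le> x / f\<close> coprime to \<open>f\<close>
  (\<open>card_level_set_eq_sum\<close>). The number of squarefree integers up to \<open>y\<close> coprime to \<open>f\<close> has density
  \<open>6 / pi\<^sup>2\<close> times the product of \<open>1 / (1 + 1 / p)\<close> over the primes \<open>p\<close> dividing \<open>f\<close>. Summing
  these densities gives the asserted series, and the sequence \<open>A\<close> enters only through the choice of the
  set of powerful numbers. Uniformity follows once all errors are bounded by sums over all powerful
  numbers.

  The delicate point is to lose only one logarithm. The local error must depend on \<open>f\<close> so mildly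
  that \<open>sqrt (x / f)\<close> times this dependence, summed over the powerful \<open>f \<le> x\<close>, is
  \<open>O(sqrt x * ln x)\<close>. Starting from the squarefree count with error \<open>3 * sqrt y\<close>
  (\<open>squarefree_count_error\<close>), the primes of \<open>f\<close> are removed one by one, each at the price of a factor
  \<open>1 / (1 - 1 / sqrt p)\<close> in the error (\<open>squarefree_avoiding_error\<close>). The product of these factors is
  at most a constant times divisor sums of \<open>a\<close> and \<open>b\<close> that are bounded on average, where
  \<open>f = a\<^sup>2 * b ^ 3\<close>. This reduces the sum of the local errors to a harmonic sum over \<open>a \<le> x\<close> and a convergent series over \<open>b\<close>
  (\<open>sum_powerful_weight_le\<close>). The same parametrization shows that the powerful \<open>f > x\<close>, which occur in
  the infinite series only, contribute \<open>O(1 / sqrt x)\<close> to it (\<open>sum_powerful_tail_le\<close>).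
\<close>

section \<open>Squarefree divisors and the Moebius function\<close>

lemma squarefree_iff_square_part_eq_1:
  fixes n :: nat
  shows "squarefree n \<longleftrightarrow> square_part n = 1"
proof
  assume "squarefree n"
  from squarefreeD[OF this square_part_square_dvd] show "square_part n = 1"
    by simp
next
  assume *: "square_part n = 1"
  show "squarefree n"
  proof (rule squarefreeI)
    fix x assume "x\<^sup>2 dvd n"
    with * show "x dvd 1"
      using dvd_square_part_iff[of x n] by simp
  qed
qed

lemma prime_factors_prod_primes:
  fixes B :: "nat set"
  assumes "finite B" "\<And>p. p \<in> B \<Longrightarrow> prime p"
  shows "prime_factors (\<Prod>B) = B"
proof -
  have "prime_factors (\<Prod>B) = (\<Union>p\<in>B. prime_factors p)"
    using assms by (subst prime_factors_prod) (auto simp: o_def dest: assms(2))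
  also have "\<dots> = (\<Union>p\<in>B. {p})"
    using assms(2) by (intro SUP_cong) (auto simp: prime_prime_factors)
  finally show ?thesis
    by simp
qed

lemma squarefree_prod_primes:
  fixes B :: "nat set"
  assumes "\<And>p. p \<in> B \<Longrightarrow> prime p"
  shows "squarefree (\<Prod>B)"
  using assms by (intro squarefree_prod_coprime) (auto simp: primes_coprime squarefree_prime)

lemma multiplicity_squarefree:
  fixes n :: nat
  assumes "squarefree n" "prime p"
  shows "multiplicity p n = (if p dvd n then 1 else 0)"
proof -
  have n0: "n \<noteq> 0"
    using assms(1) by (intro notI) simp
  then show ?thesis
    using assms unfolding squarefree_factorial_semiring'[OF n0]
    by (auto simp: not_dvd_imp_multiplicity_0 in_prime_factors_iff)
qed

lemma prod_prime_factors_squarefree: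
  fixes n :: nat
  assumes "squarefree n"
  shows "\<Prod>(prime_factors n) = n"
proof (rule multiplicity_eq_nat)
  have n0: "n \<noteq> 0"
    using assms by (intro notI) auto
  then show "0 < n"
    by simp
  show "0 < \<Prod>(prime_factors n)"
    by (intro prod_pos) (auto simp: prime_gt_0_nat in_prime_factors_iff)
  fix p :: nat assume p: "prime p"
  have "multiplicity p (\<Prod>(prime_factors n)) = (if p \<in> prime_factors n then 1 else 0)"
    using multiplicity_prod_prime_powers[of "prime_factors n" p "\<lambda>_. 1"] p
    by (auto simp: in_prime_factors_iff)
  also have "\<dots> = multiplicity p n"
    using n0 p multiplicity_squarefree[OF assms p] by (simp add: in_prime_factors_iff)
  finally show "multiplicity p (\<Prod>(prime_factors n)) = multiplicity p n" .
qed

text \<open>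
  This turns a product over the primes dividing \<open>n\<close>, expanded into a sum over subsets, into a
  sum over divisors. It serves both the Moebius function and the bound for Euler products below.
\<close>

lemma sum_squarefree_divisors:
  fixes F :: "nat \<Rightarrow> 'a::comm_monoid_add"
  assumes "n > 0"
  shows "(\<Sum>d | d dvd n \<and> squarefree d. F d) = (\<Sum>B\<in>Pow (prime_factors n). F (\<Prod>B))"
proof (rule sum.reindex_bij_witness[of _ "\<lambda>B. \<Prod>B" prime_factors], goal_cases)
  case (1 d)
  then show ?case
    by (simp add: prod_prime_factors_squarefree)
next
  case (2 d)
  then show ?case
    using assms by (auto simp: in_prime_factors_iff)
next
  case (3 B)
  then have "B \<subseteq> prime_factors n"
    by simp
  then show ?case
    by (intro prime_factors_prod_primes) (auto intro: finite_subset)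
next
  case (4 B)
  then have B: "B \<subseteq> prime_factors n"
    by simp
  have sq: "squarefree (\<Prod>B)"
    using B by (intro squarefree_prod_primes) auto
  have "\<Prod>B dvd n"
  proof (rule multiplicity_le_imp_dvd)
    show "\<Prod>B \<noteq> 0"
      using sq by (intro notI) simp
    fix p :: nat assume p: "prime p"
    have "finite B"
      using B by (rule finite_subset) simp
    have primes: "prime q" if "q \<in> B" for q
      using that B by auto
    have "multiplicity p (\<Prod>B) = (if p \<in> B then 1 else 0)"
      using multiplicity_prod_prime_powers[OF \<open>finite B\<close> primes p, of "\<lambda>_. 1"]
      by simp
    also have "\<dots> \<le> multiplicity p n"
      using B p assms by (auto simp: prime_factors_multiplicity)
    finally show "multiplicity p (\<Prod>B) \<le> multiplicity p n" .
  qed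
  with sq show ?case
    by simp
next
  case (5 d)
  then show ?case
    by (simp add: prod_prime_factors_squarefree)
qed

definition moebius :: "nat \<Rightarrow> real" where
  "moebius n = (if squarefree n then (-1) ^ card (prime_factors n) else 0)"

lemma abs_moebius_le_1: "\<bar>moebius n\<bar> \<le> 1"
  by (simp add: moebius_def power_abs)

text \<open>
  Summing over subsets of the set of prime factors gives the product of \<open>- 1 + 1\<close> over the
  primes dividing \<open>n\<close>, which is empty only for \<open>n = 1\<close>.
\<close>

lemma sum_moebius_divisors:
  assumes "n > 0"
  shows "(\<Sum>d | d dvd n. moebius d) = (if n = 1 then 1 else 0)"
proof -
  have "(\<Sum>d | d dvd n. moebius d) = (\<Sum>d | d dvd n \<and> squarefree d. moebius d)"
    using assms by (intro sum.mono_neutral_right) (auto simp: moebius_def)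
  also have "\<dots> = (\<Sum>B\<in>Pow (prime_factors n). moebius (\<Prod>B))"
    by (rule sum_squarefree_divisors) fact
  also have "\<dots> = (\<Sum>B\<in>Pow (prime_factors n). (\<Prod>p\<in>B. - 1) * (\<Prod>p\<in>prime_factors n - B. 1))"
  proof (rule sum.cong)
    fix B assume "B \<in> Pow (prime_factors n)"
    then have B: "B \<subseteq> prime_factors n" "finite B"
      by (auto intro: finite_subset)
    have "squarefree (\<Prod>B)" "prime_factors (\<Prod>B) = B"
      using B by (auto intro!: squarefree_prod_primes prime_factors_prod_primes)
    then show "moebius (\<Prod>B) = (\<Prod>p\<in>B. - 1) * (\<Prod>p\<in>prime_factors n - B. 1)"
      by (simp add: moebius_def)
  qed simp
  also have "\<dots> = (\<Prod>p\<in>prime_factors n. - 1 + 1)"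
    by (rule prod_add[symmetric]) simp
  also have "\<dots> = (if n = 1 then 1 else 0)"
    using assms by (auto simp: card_gt_0_iff prime_factorization_empty_iff)
  finally show ?thesis .
qed

text \<open>
  The \<open>k\<close> with \<open>k\<^sup>2\<close> dividing \<open>n\<close> are the divisors of the largest such \<open>k\<close>.
\<close>

lemma sum_moebius_square_divisors:
  assumes "n > 0"
  shows "(\<Sum>k | k\<^sup>2 dvd n. moebius k) = (if squarefree n then 1 else 0)"
proof -
  have "(\<Sum>k | k\<^sup>2 dvd n. moebius k) = (\<Sum>k | k dvd square_part n. moebius k)"
    by (simp add: dvd_square_part_iff)
  also have "\<dots> = (if squarefree n then 1 else 0)"
  proof (subst sum_moebius_divisors)
    show "0 < square_part n"
      using assms by (intro Nat.gr0I) simp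
  qed (simp add: squarefree_iff_square_part_eq_1)
  finally show ?thesis .
qed

section \<open>Counting squarefree numbers\<close>

lemma has_sum_inverse_squares: "((\<lambda>k::nat. 1 / real k ^ 2) has_sum pi\<^sup>2 / 6) {1..}"
proof -
  have "((\<lambda>n::nat. 1 / (real n + 1)\<^sup>2) has_sum (pi\<^sup>2 / 6)) UNIV"
    using inverse_squares_sums by (intro sums_nonneg_imp_has_sum) (simp_all add: add.commute)
  also have "?this \<longleftrightarrow> ?thesis"
    by (intro has_sum_reindex_bij_witness[of _ "\<lambda>k. k - 1" Suc]) (auto simp: add.commute)
  finally show ?thesis .
qed

lemma summable_moebius_squares: "(\<lambda>k. norm (moebius k / real k ^ 2)) summable_on {1..}"
proof (rule summable_on_comparison_test)
  show "(\<lambda>k::nat. 1 / real k ^ 2) summable_on {1..}"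
    using has_sum_inverse_squares by (rule has_sum_imp_summable)
  show "norm (moebius k / (real k)\<^sup>2) \<le> 1 / (real k)\<^sup>2" for k
    using abs_moebius_le_1[of k] by (simp add: divide_right_mono)
qed auto

text \<open>
  The Dirichlet series of the Moebius function is inverse to the zeta function, here at \<open>2\<close>:
  grouping the double series of \<open>moebius k / (k * j)\<^sup>2\<close> by \<open>n = k * j\<close> leaves only \<open>n = 1\<close>.
\<close>

lemma infsum_moebius_squares: "(\<Sum>\<^sub>\<infinity>k\<in>{1..}. moebius k / real k ^ 2) = 6 / pi\<^sup>2"
proof -
  define f where "f = (\<lambda>k. moebius k / real k ^ 2)"
  define g where "g = (\<lambda>k::nat. 1 / real k ^ 2)"
  define M where "M = (\<Sum>\<^sub>\<infinity>k\<in>{1..}. f k)"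
  have f: "(f has_sum M) {1..}"
    unfolding M_def f_def using summable_moebius_squares
    by (intro has_sum_infsum) (rule abs_summable_summable)
  have "(\<lambda>(k, j). norm (f k * g j)) summable_on {1..} \<times> {1..}"
  proof (rule summable_on_SigmaI)
    show "((\<lambda>j. (case (k, j) of (k, j) \<Rightarrow> norm (f k * g j))) has_sum norm (f k) * (pi\<^sup>2 / 6)) {1..}" for k
      using has_sum_cmult_right[OF has_sum_inverse_squares, of "norm (f k)"]
      by (simp add: g_def abs_mult)
    show "(\<lambda>k. norm (f k) * (pi\<^sup>2 / 6)) summable_on {1..}"
      using summable_moebius_squares unfolding f_def by (rule summable_on_cmult_left)
  qed auto
  then have sm: "(\<lambda>(k, j). f k * g j) summable_on {1..} \<times> {1..}"
    unfolding case_prod_unfold by (rule abs_summable_summable)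
  have S: "((\<lambda>(k, j). f k * g j) has_sum (M * (pi\<^sup>2 / 6))) ({1..} \<times> {1..})"
  proof (rule has_sum_SigmaI)
    show "((\<lambda>j. (case (k, j) of (k, j) \<Rightarrow> f k * g j)) has_sum f k * (pi\<^sup>2 / 6)) {1..}" for k
      using has_sum_cmult_right[OF has_sum_inverse_squares, of "f k"] by (simp add: g_def)
    show "((\<lambda>k. f k * (pi\<^sup>2 / 6)) has_sum M * (pi\<^sup>2 / 6)) {1..}"
      by (intro has_sum_cmult_left f)
  qed (rule sm)
  also have "?this \<longleftrightarrow> ((\<lambda>(n, k). moebius k / real n ^ 2) has_sum (M * (pi\<^sup>2 / 6)))
      (SIGMA n:{1..}. {k. k dvd n})"
  proof (rule has_sum_reindex_bij_witness[of _ "\<lambda>(n, k). (k, n div k)" "\<lambda>(k, j). (k * j, k)"],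
      goal_cases)
    case (1 x)
    then show ?case
      by (cases x) simp
  next
    case (2 x)
    then show ?case
      by (cases x) simp
  next
    case (3 x)
    then show ?case
      by (cases x) simp
  next
    case (4 x)
    obtain n k where x: "x = (n, k)"
      by (cases x)
    have "n > 0" "k dvd n"
      using 4 by (auto simp: x)
    then have "k > 0" "n div k > 0"
      by (auto simp: div_greater_zero_iff dvd_imp_le intro!: Nat.gr0I)
    then show ?case
      by (simp add: x Suc_le_eq)
  next
    case (5 x)
    then show ?case
      by (cases x) (simp add: f_def g_def power_mult_distrib)
  qed simp
  finally have "((\<lambda>(n, k). moebius k / real n ^ 2) has_sum (M * (pi\<^sup>2 / 6)))
      (SIGMA n:{1..}. {k. k dvd n})" .
  then have "((\<lambda>n::nat. if n = 1 then 1 else 0) has_sum (M * (pi\<^sup>2 / 6))) {1..}"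
  proof (rule has_sum_SigmaD)
    fix n :: nat assume n: "n \<in> {1..}"
    have "((\<lambda>k. moebius k / real n ^ 2) has_sum (\<Sum>k | k dvd n. moebius k / real n ^ 2)) {k. k dvd n}"
      using n by (intro has_sum_finite) simp
    also have "(\<Sum>k | k dvd n. moebius k / real n ^ 2) = (if n = 1 then 1 else 0)"
    proof -
      have "(\<Sum>k | k dvd n. moebius k / real n ^ 2) = (\<Sum>k | k dvd n. moebius k) / real n ^ 2"
        by (simp only: sum_divide_distrib)
      also have "\<dots> = (if n = 1 then 1 else 0) / real n ^ 2"
        using n by (subst sum_moebius_divisors) simp_all
      finally show ?thesis
        by simp
    qed
    finally show "((\<lambda>k. case (n, k) of (n, k) \<Rightarrow> moebius k / real n ^ 2)
        has_sum (if n = 1 then 1 else 0)) {k. k dvd n}"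
      by simp
  qed
  moreover have "((\<lambda>n::nat. if n = 1 then 1 else 0 :: real) has_sum 1) {1..}"
    by (rule has_sum_finite_neutralI[of "{1}"]) auto
  ultimately have "M * (pi\<^sup>2 / 6) = 1"
    by (rule has_sum_unique)
  then have "M = 6 / pi\<^sup>2"
    by (simp add: divide_simps mult.commute)
  then show ?thesis
    by (simp only: M_def f_def)
qed

lemma six_over_pi_squared_le_1: "6 / pi\<^sup>2 \<le> 1"
proof -
  have "3 ^ 2 \<le> pi ^ 2"
    using pi_gt3 by (intro power_mono) auto
  then show ?thesis
    by simp
qed

text \<open>
  Beyond its first term the sum over \<open>k \<ge> a\<close> is dominated by the telescoping sum of
  \<open>1 / (k - 1) - 1 / k\<close>, and \<open>a\<close> is taken to be the least integer above \<open>t\<close>. The first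
  term makes the constant \<open>2\<close>.
\<close>

lemma sum_inverse_squares_tail_le:
  assumes "finite K" "t > 0" "\<And>k. k \<in> K \<Longrightarrow> t < real k"
  shows "(\<Sum>k\<in>K. 1 / real k ^ 2) \<le> 2 / t"
proof -
  define a where "a = nat \<lfloor>t\<rfloor> + 1"
  have a: "real a > t" "a \<ge> 1"
    using assms(2) by (auto simp: a_def) linarith
  have K: "K \<subseteq> {a..Max (insert a K)}"
  proof
    fix k assume k: "k \<in> K"
    then have "t < real k"
      by (rule assms(3))
    then have "\<lfloor>t\<rfloor> < int k"
      by linarith
    then have "a \<le> k"
      unfolding a_def using assms(2) by (simp add: Suc_le_eq nat_less_iff)
    with k assms(1) show "k \<in> {a..Max (insert a K)}"
      by simp
  qed
  have tel: "(\<Sum>k\<in>{a..b}. 1 / real k ^ 2) \<le> 2 / real a - 1 / real b" if "a \<le> b" for b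
    using that
  proof (induction b rule: dec_induct)
    case base
    have "1 / real a ^ 2 \<le> 1 / real a"
      using a by (intro divide_left_mono) (auto simp: power2_eq_square)
    then show ?case
      by simp
  next
    case (step b)
    have "1 / real (Suc b) ^ 2 \<le> 1 / real b - 1 / real (Suc b)"
    proof -
      have "1 / real (Suc b) ^ 2 \<le> 1 / (real b * real (Suc b))"
        using a step by (intro divide_left_mono) (auto simp: power2_eq_square)
      also have "\<dots> = 1 / real b - 1 / real (Suc b)"
        using a step by (subst diff_frac_eq) auto
      finally show ?thesis .
    qed
    with step show ?case
      by simp
  qed
  have "(\<Sum>k\<in>K. 1 / real k ^ 2) \<le> (\<Sum>k\<in>{a..Max (insert a K)}. 1 / real k ^ 2)"
    using K by (intro sum_mono2) auto
  also have "\<dots> \<le> 2 / real a"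
    using tel[of "Max (insert a K)"] assms(1) by (smt (verit) Max_ge divide_nonneg_nonneg finite_insert insertI1 of_nat_0_le_iff)
  also have "\<dots> \<le> 2 / t"
    using a assms(2) by (intro divide_left_mono) auto
  finally show ?thesis .
qed

lemma card_multiples_nat:
  fixes d N :: nat
  assumes "d > 0"
  shows "card {n\<in>{1..N}. d dvd n} = N div d"
proof -
  have "bij_betw (\<lambda>q. q * d) {1..N div d} {n\<in>{1..N}. d dvd n}"
  proof (rule bij_betw_byWitness[where f' = "\<lambda>n. n div d"])
    show "(\<lambda>q. q * d) ` {1..N div d} \<subseteq> {n \<in> {1..N}. d dvd n}"
      using assms by (auto simp: less_eq_div_iff_mult_less_eq)
    show "(\<lambda>n. n div d) ` {n \<in> {1..N}. d dvd n} \<subseteq> {1..N div d}"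
      using assms by (auto simp: Suc_le_eq div_greater_zero_iff dvd_imp_le div_le_mono)
  qed (use assms in auto)
  from bij_betw_same_card[OF this] show ?thesis
    by simp
qed

text \<open>
  Inclusion-exclusion over squares: the number of squarefree \<open>n \<le> y\<close> is the sum of
  \<open>moebius k * \<lfloor>y / k\<^sup>2\<rfloor>\<close> over \<open>k \<le> sqrt y\<close>. Removing the floors costs at most \<open>sqrt y\<close>, and
  completing the series costs at most \<open>2 * sqrt y\<close>.
\<close>

lemma squarefree_count_error:
  fixes y :: real
  assumes y: "y > 0"
  shows "\<bar>real (card {n\<in>{1..nat \<lfloor>y\<rfloor>}. squarefree n}) - 6 / pi\<^sup>2 * y\<bar> \<le> 3 * sqrt y"
proof -
  define N where N: "N = nat \<lfloor>y\<rfloor>"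
  define R where "R = nat \<lfloor>sqrt y\<rfloor>"
  define f where "f = (\<lambda>k. moebius k / real k ^ 2)"
  have Ry: "real R \<le> sqrt y"
    using y by (simp add: R_def)
  have Riff: "k \<le> R \<longleftrightarrow> real k \<le> sqrt y" for k
    using y by (simp add: R_def le_nat_iff le_floor_iff)
  have sqN: "k \<le> R" if "k\<^sup>2 dvd n" "n \<in> {1..N}" for k n
  proof -
    have "real (k\<^sup>2) \<le> y"
    proof -
      have "k\<^sup>2 \<le> n" "0 < n" "n \<le> N"
        using dvd_imp_le[OF that(1)] that(2) by auto
      moreover from this have "real N \<le> y"
        unfolding N using y by simp
      ultimately show ?thesis
        by (meson of_nat_le_iff order_trans)
    qed
    then have "real k \<le> sqrt y"
      by (intro real_le_rsqrt) simp
    then show ?thesis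
      by (simp add: Riff)
  qed
  have "real (card {n\<in>{1..N}. squarefree n}) = (\<Sum>n\<in>{1..N}. if squarefree n then 1 else 0)"
    by (simp add: sum.If_cases Int_def)
  also have "\<dots> = (\<Sum>n\<in>{1..N}. \<Sum>k | k\<^sup>2 dvd n. moebius k)"
    by (intro sum.cong) (auto simp: sum_moebius_square_divisors)
  also have "\<dots> = (\<Sum>n\<in>{1..N}. \<Sum>k | k \<in> {1..R} \<and> k\<^sup>2 dvd n. moebius k)"
    using sqN by (intro sum.cong refl) (auto simp: Suc_le_eq intro!: Nat.gr0I)
  also have "\<dots> = (\<Sum>k\<in>{1..R}. \<Sum>n | n \<in> {1..N} \<and> k\<^sup>2 dvd n. moebius k)"
    by (rule sum.swap_restrict) auto
  also have "\<dots> = (\<Sum>k\<in>{1..R}. moebius k * real (N div k\<^sup>2))"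
    using card_multiples_nat by (intro sum.cong) simp_all
  finally have Q: "real (card {n\<in>{1..N}. squarefree n}) = (\<Sum>k\<in>{1..R}. moebius k * real (N div k\<^sup>2))" .
  have floor_err: "\<bar>moebius k * real (N div k\<^sup>2) - f k * y\<bar> \<le> 1" if k: "k \<in> {1..R}" for k
  proof -
    have "N div k\<^sup>2 = nat \<lfloor>y / real (k\<^sup>2)\<rfloor>"
      unfolding N using y floor_divide_real_eq_div[of "int (k\<^sup>2)" y]
      by (simp add: nat_div_distrib nat_power_eq)
    then have "\<bar>real (N div k\<^sup>2) - y / real k ^ 2\<bar> \<le> 1"
      using y by (simp; linarith)
    then have "\<bar>moebius k\<bar> * \<bar>real (N div k\<^sup>2) - y / real k ^ 2\<bar> \<le> 1 * 1"
      using abs_moebius_le_1 by (intro mult_mono) auto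
    then show ?thesis
      by (simp add: f_def algebra_simps flip: abs_mult)
  qed
  have "\<bar>(\<Sum>k\<in>{1..R}. moebius k * real (N div k\<^sup>2)) - (\<Sum>k\<in>{1..R}. f k) * y\<bar>
      \<le> (\<Sum>k\<in>{1..R}. \<bar>moebius k * real (N div k\<^sup>2) - f k * y\<bar>)"
    unfolding sum_distrib_right sum_subtractf[symmetric] by (rule sum_abs)
  also have "\<dots> \<le> (\<Sum>k\<in>{1..R}. 1)"
    using floor_err by (rule sum_mono)
  also have "\<dots> \<le> sqrt y"
    using Ry by simp
  finally have E1: "\<bar>real (card {n\<in>{1..N}. squarefree n}) - (\<Sum>k\<in>{1..R}. f k) * y\<bar> \<le> sqrt y"
    using Q by simp
  have abs_f: "(\<lambda>k. norm (f k)) summable_on {1..}"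
    using summable_moebius_squares by (simp add: f_def)
  then have abs_tail: "(\<lambda>k. norm (f k)) summable_on {R<..}"
    by (rule summable_on_subset_banach) auto
  have "6 / pi\<^sup>2 = infsum f ({1..R} \<union> {R<..})"
    unfolding infsum_moebius_squares[symmetric] f_def by (intro arg_cong2[where f = infsum]) auto
  also have "\<dots> = infsum f {1..R} + infsum f {R<..}"
    using abs_summable_summable[OF abs_tail] by (intro infsum_Un_disjoint) auto
  finally have split: "6 / pi\<^sup>2 = (\<Sum>k\<in>{1..R}. f k) + infsum f {R<..}"
    by simp
  have "\<bar>infsum f {R<..}\<bar> \<le> infsum (\<lambda>k. \<bar>f k\<bar>) {R<..}"
    using norm_infsum_bound[OF abs_tail] by simp
  also have "\<dots> \<le> 2 / sqrt y"
  proof (rule infsum_le_finite_sums)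
    show "(\<lambda>k. \<bar>f k\<bar>) summable_on {R<..}"
      using abs_tail by simp
    fix K assume K: "finite K" "K \<subseteq> {R<..}"
    have "(\<Sum>k\<in>K. \<bar>f k\<bar>) \<le> (\<Sum>k\<in>K. 1 / real k ^ 2)"
      unfolding f_def using abs_moebius_le_1 by (intro sum_mono) (auto simp: divide_right_mono)
    also have "\<dots> \<le> 2 / sqrt y"
    proof (rule sum_inverse_squares_tail_le)
      fix k assume "k \<in> K"
      then have "\<not> k \<le> R"
        using K by auto
      then show "sqrt y < real k"
        by (simp add: Riff)
    qed (use K y in auto)
    finally show "(\<Sum>k\<in>K. \<bar>f k\<bar>) \<le> 2 / sqrt y" .
  qed
  finally have "\<bar>infsum f {R<..}\<bar> * y \<le> 2 / sqrt y * y"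
    using y by (intro mult_right_mono) auto
  also have "2 / sqrt y * y = 2 * sqrt y"
    using y by (simp add: field_simps)
  finally have "\<bar>infsum f {R<..} * y\<bar> \<le> 2 * sqrt y"
    using y by (simp add: abs_mult)
  moreover have "6 / pi\<^sup>2 * y = (\<Sum>k\<in>{1..R}. f k) * y + infsum f {R<..} * y"
    by (simp add: split algebra_simps)
  moreover have "0 \<le> sqrt y"
    using y by simp
  ultimately show ?thesis
    using E1 unfolding N by linarith
qed

section \<open>Squarefree numbers avoiding finitely many primes\<close>

definition squarefree_avoiding :: "nat set \<Rightarrow> real \<Rightarrow> nat set" where
  "squarefree_avoiding P y = {n. 0 < n \<and> real n \<le> y \<and> squarefree n \<and> (\<forall>p\<in>P. \<not> p dvd n)}"

lemma finite_squarefree_avoiding: "finite (squarefree_avoiding P y)"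
proof (rule finite_subset)
  show "squarefree_avoiding P y \<subseteq> {..nat \<lfloor>y\<rfloor>}"
    by (auto simp: squarefree_avoiding_def le_nat_floor)
qed simp

text \<open>
  Sort the elements by divisibility by \<open>p\<close>; a squarefree multiple of \<open>p\<close> is \<open>p\<close> times a squarefree
  number that \<open>p\<close> does not divide.
\<close>

lemma card_squarefree_avoiding_insert:
  assumes "prime p" "p \<notin> P" "\<And>q. q \<in> P \<Longrightarrow> prime q"
  shows "card (squarefree_avoiding P y) =
    card (squarefree_avoiding (insert p P) y) + card (squarefree_avoiding (insert p P) (y / real p))"
proof -
  have p0: "p > 0"
    using assms(1) by (rule prime_gt_0_nat)
  have "squarefree_avoiding P y = squarefree_avoiding (insert p P) y \<union>
      (\<lambda>n. p * n) ` squarefree_avoiding (insert p P) (y / real p)" (is "?S = ?A \<union> ?B")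
  proof (intro equalityI subsetI)
    fix n assume n: "n \<in> ?S"
    show "n \<in> ?A \<union> ?B"
    proof (cases "p dvd n")
      case False
      with n show ?thesis
        by (auto simp: squarefree_avoiding_def)
    next
      case True
      then obtain k where k: "n = p * k"
        by (elim dvdE)
      have sq: "squarefree (p * k)"
        using n by (simp add: squarefree_avoiding_def k)
      have "\<not> p dvd k"
        using squarefreeD[OF sq, of p] assms(1) by (auto simp: power2_eq_square)
      moreover have "real k \<le> y / real p"
        using n p0 by (simp add: squarefree_avoiding_def k field_simps)
      ultimately have "k \<in> squarefree_avoiding (insert p P) (y / real p)"
        using n squarefree_multD(2)[OF sq] by (auto simp: squarefree_avoiding_def k)
      then show ?thesis
        unfolding k by blast
    qed
  next
    fix n assume "n \<in> ?A \<union> ?B"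
    then show "n \<in> ?S"
    proof
      assume "n \<in> ?B"
      then obtain k where k: "n = p * k" "k \<in> squarefree_avoiding (insert p P) (y / real p)"
        by auto
      have "coprime p k"
        using k(2) assms(1) by (auto simp: squarefree_avoiding_def prime_imp_coprime)
      then have "squarefree n"
        unfolding k(1) using k(2) squarefree_prime[OF assms(1)]
        by (intro squarefree_mult_coprime) (auto simp: squarefree_avoiding_def)
      moreover have "\<not> q dvd n" if "q \<in> P" for q
      proof
        assume "q dvd n"
        then have "q dvd p \<or> q dvd k"
          using assms(3)[OF that] by (simp add: k prime_dvd_mult_iff)
        moreover have "\<not> q dvd p"
          using primes_dvd_imp_eq[OF assms(3)[OF that] assms(1)] that assms(2) by auto
        ultimately show False
          using k(2) that by (auto simp: squarefree_avoiding_def)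
      qed
      ultimately show ?thesis
        using k p0 by (auto simp: squarefree_avoiding_def field_simps)
    qed (auto simp: squarefree_avoiding_def)
  qed
  moreover have "?A \<inter> ?B = {}"
    by (auto simp: squarefree_avoiding_def)
  moreover have "card ?B = card (squarefree_avoiding (insert p P) (y / real p))"
    using p0 by (intro card_image) (auto simp: inj_on_def)
  ultimately show ?thesis
    by (simp add: card_Un_disjoint finite_squarefree_avoiding)
qed

lemma squarefree_avoiding_empty_error:
  assumes "y > 0"
  shows "\<bar>real (card (squarefree_avoiding {} y)) - 6 / pi\<^sup>2 * y\<bar> \<le> 3 * sqrt y"
proof -
  have "squarefree_avoiding {} y = {n\<in>{1..nat \<lfloor>y\<rfloor>}. squarefree n}"
    using assms by (auto simp: squarefree_avoiding_def Suc_le_eq le_nat_iff le_floor_iff)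
  then show ?thesis
    using squarefree_count_error[OF assms] by simp
qed

text \<open>
  Add the primes one at a time. Let \<open>S\<close> and \<open>S'\<close> be the counting functions before and after adding
  \<open>p\<close>. From \<open>S' y = S y - S' (y / p)\<close> the error constants need only satisfy
  \<open>K' = K + K' / sqrt p\<close>, so that \<open>p\<close> contributes the factor \<open>1 / (1 - 1 / sqrt p)\<close>. This factor is
  close to \<open>1\<close> for large \<open>p\<close>; sieving by divisors would give a factor \<open>2\<close> for every prime, and
  then the final sum over powerful numbers would have size \<open>ln x ^ 2\<close> and not \<open>ln x\<close>.
\<close>

lemma squarefree_avoiding_error:
  assumes "finite P" "\<And>p. p \<in> P \<Longrightarrow> prime p" "y > 0"
  shows "\<bar>real (card (squarefree_avoiding P y)) - 6 / pi\<^sup>2 * (\<Prod>p\<in>P. inverse (1 + 1 / real p)) * y\<bar>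
    \<le> 3 * sqrt y * (\<Prod>p\<in>P. inverse (1 - 1 / sqrt (real p)))"
  using assms
proof (induction P arbitrary: y rule: finite_induct)
  case empty
  then show ?case
    using squarefree_avoiding_empty_error by simp
next
  case (insert p P)
  define S where "S = (\<lambda>y. real (card (squarefree_avoiding P y)))"
  define S' where "S' = (\<lambda>y. real (card (squarefree_avoiding (insert p P) y)))"
  define c where "c = 6 / pi\<^sup>2 * (\<Prod>q\<in>P. inverse (1 + 1 / real q))"
  define K where "K = (\<Prod>q\<in>P. inverse (1 - 1 / sqrt (real q)))"
  define c' where "c' = c * inverse (1 + 1 / real p)"
  define K' where "K' = K * inverse (1 - 1 / sqrt (real p))"
  have p: "prime p"
    using insert.prems by simp
  have sqrt_p: "sqrt (real q) > 1" if "prime q" for q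
    using prime_gt_1_nat[OF that] by simp
  have rec: "S y = S' y + S' (y / real p)" for y
    unfolding S_def S'_def using card_squarefree_avoiding_insert[of p P y] insert p
    by simp
  have IH: "\<bar>S y - c * y\<bar> \<le> 3 * sqrt y * K" if "y > 0" for y
    unfolding S_def c_def K_def using insert.IH[OF _ that] insert.prems by simp
  have c'_eq: "c = c' * (1 + 1 / real p)"
  proof -
    have "1 + 1 / real p \<noteq> 0"
      using prime_gt_0_nat[OF p] by (simp add: add_nonneg_eq_0_iff)
    then show ?thesis
      by (simp add: c'_def)
  qed
  have K'_eq: "K = K' * (1 - 1 / sqrt (real p))"
  proof -
    have "1 - 1 / sqrt (real p) \<noteq> 0"
      using sqrt_p[OF p] by (simp add: divide_simps)
    then show ?thesis
      by (simp add: K'_def)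
  qed
  have "1 \<le> K'"
  proof -
    have "1 \<le> (\<Prod>q\<in>insert p P. inverse (1 - 1 / sqrt (real q)))"
    proof (rule prod_ge_1)
      fix q assume "q \<in> insert p P"
      then have "sqrt (real q) > 1"
        using insert.prems by (intro sqrt_p) auto
      then show "1 \<le> inverse (1 - 1 / sqrt (real q))"
        by (intro one_le_inverse) (auto simp: field_simps)
    qed
    then show ?thesis
      using insert.hyps by (simp add: K'_def K_def mult.commute)
  qed
  have c': "0 \<le> c'" "c' \<le> 1"
  proof -
    have "(\<Prod>q\<in>insert p P. inverse (1 + 1 / real q)) \<le> 1"
      by (intro prod_le_1) (auto simp: inverse_le_1_iff)
    moreover have "0 \<le> (\<Prod>q\<in>insert p P. inverse (1 + 1 / real q))"
      by (intro prod_nonneg) auto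
    moreover have "6 / pi\<^sup>2 \<le> 1"
      by (rule six_over_pi_squared_le_1)
    moreover have "c' = 6 / pi\<^sup>2 * (\<Prod>q\<in>insert p P. inverse (1 + 1 / real q))"
      using insert.hyps by (simp add: c'_def c_def mult_ac)
    ultimately show "0 \<le> c'" "c' \<le> 1"
      by (simp_all add: mult_le_one del: prod.insert)
  qed
  \<comment> \<open>The recurrence relates \<open>S'\<close> at \<open>y\<close> to \<open>S'\<close> at \<open>y / p \<le> y / 2\<close>, so a second induction on the
    binary size of \<open>y\<close> is required; it ends at \<open>y < 1\<close>, where nothing is counted.\<close>
  have "\<bar>S' y - c' * y\<bar> \<le> 3 * sqrt y * K'" if "0 < y" "y < 2 ^ n" for n y
    using that
  proof (induction n arbitrary: y)
    case 0
    then have "squarefree_avoiding (insert p P) y = {}"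
      by (auto simp: squarefree_avoiding_def)
    then have "\<bar>S' y - c' * y\<bar> = c' * y"
      using c' 0 by (simp add: S'_def)
    also have "\<dots> \<le> 1 * (sqrt y * sqrt y)"
      using c' 0 by (intro mult_mono) auto
    also have "\<dots> \<le> 1 * (sqrt y * 1)"
      using 0 by (intro mult_mono) auto
    also have "\<dots> \<le> 3 * sqrt y * K'"
      using \<open>1 \<le> K'\<close> 0 by (intro order_trans[OF _ mult_left_mono[OF \<open>1 \<le> K'\<close>]]) auto
    finally show ?case .
  next
    case (Suc n)
    have p2: "real p \<ge> 2"
      using prime_ge_2_nat[OF p] by simp
    have "y / real p \<le> y / 2"
      using p2 Suc.prems by (intro divide_left_mono) auto
    then have "y / real p < 2 ^ n"
      using Suc.prems unfolding power_Suc by linarith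
    then have E': "\<bar>S' (y / real p) - c' * (y / real p)\<bar> \<le> 3 * sqrt (y / real p) * K'"
      using Suc.prems p2 by (intro Suc.IH) auto
    have E: "\<bar>S y - c * y\<bar> \<le> 3 * sqrt y * K"
      using Suc.prems by (intro IH) auto
    have "S' y - c' * y = (S y - c * y) - (S' (y / real p) - c' * (y / real p))"
      using rec[of y] by (simp add: c'_eq algebra_simps)
    then have "\<bar>S' y - c' * y\<bar> \<le> 3 * sqrt y * K + 3 * sqrt (y / real p) * K'"
      using E E' by linarith
    also have "\<dots> = 3 * sqrt y * K'"
      using sqrt_p[OF p] by (simp add: K'_eq real_sqrt_divide algebra_simps)
    finally show ?case .
  qed
  moreover obtain n where "y < 2 ^ n"
    using real_arch_pow[of 2 y] by auto
  ultimately have "\<bar>S' y - c' * y\<bar> \<le> 3 * sqrt y * K'"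
    using insert.prems by blast
  then show ?case
    using insert.hyps by (simp add: S'_def c'_def c_def K'_def K_def mult_ac)
qed

section \<open>Sums over powerful numbers\<close>

text \<open>
  Take for \<open>b\<close> the product of the primes with odd multiplicity. Such a multiplicity is at least
  \<open>3\<close>, hence \<open>b\<close> also divides the square root of \<open>f / b\<close>.
\<close>

lemma powerful_eq_square_times_cube:
  assumes "powerful f"
  shows "\<exists>a b. 0 < a \<and> 0 < b \<and> f = a\<^sup>2 * b ^ 3"
proof -
  have f: "f > 0" "\<And>p. p \<in> prime_factors f \<Longrightarrow> 2 \<le> multiplicity p f"
    using assms by (auto simp: powerful_def)
  have "squarefree_part f dvd square_part f"
  proof (rule multiplicity_le_imp_dvd)
    fix p :: nat assume p: "prime p"
    show "multiplicity p (squarefree_part f) \<le> multiplicity p (square_part f)"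
    proof (cases "p dvd f")
      case True
      then have "2 \<le> multiplicity p f"
        using p f by (intro f(2)) (auto simp: in_prime_factors_iff)
      then have "1 \<le> multiplicity p f div 2"
        by simp
      moreover have "multiplicity p f mod 2 \<le> 1"
        by simp
      ultimately show ?thesis
        using p by (simp add: prime_multiplicity_squarefree_part prime_multiplicity_square_part)
    next
      case False
      then show ?thesis
        using p by (simp add: prime_multiplicity_squarefree_part not_dvd_imp_multiplicity_0)
    qed
  qed simp
  then obtain a where a: "square_part f = squarefree_part f * a"
    by (elim dvdE)
  have eq: "f = a\<^sup>2 * squarefree_part f ^ 3"
    by (subst squarefree_decompose[of f], subst a) (simp add: power2_eq_square power3_eq_cube)
  moreover have "a > 0"
    using f(1) eq by (intro Nat.gr0I) auto
  moreover have "squarefree_part f > 0"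
    by (intro Nat.gr0I) simp
  ultimately show ?thesis
    by blast
qed

text \<open>
  In standard notation this is the divisor function \<open>\<sigma>\<close> with exponent \<open>- 1 / 4\<close>. Any exponent
  strictly between \<open>- 1 / 2\<close> and \<open>0\<close> would serve: above \<open>- 1 / 2\<close>, so that the weight absorbs
  the Euler factors \<open>1 / (1 - 1 / sqrt p)\<close>, and below \<open>0\<close>, so that the weight is bounded on average.
\<close>

definition divisor_weight :: "nat \<Rightarrow> real" where
  "divisor_weight n = (\<Sum>d | d dvd n. 1 / sqrt (sqrt (real d)))"

lemma divisor_weight_nonneg: "0 \<le> divisor_weight n"
  unfolding divisor_weight_def by (intro sum_nonneg) auto

lemma prod_le_divisor_weight:
  assumes "n > 0"
  shows "(\<Prod>p\<in>prime_factors n. 1 + 1 / sqrt (sqrt (real p))) \<le> divisor_weight n"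
proof -
  have "(\<Prod>p\<in>prime_factors n. 1 + 1 / sqrt (sqrt (real p))) =
      (\<Prod>p\<in>prime_factors n. 1 / sqrt (sqrt (real p)) + 1)"
    by (simp add: add.commute)
  also have "\<dots> = (\<Sum>B\<in>Pow (prime_factors n). (\<Prod>p\<in>B. 1 / sqrt (sqrt (real p))) * (\<Prod>p\<in>prime_factors n - B. 1))"
    by (rule prod_add) simp
  also have "\<dots> = (\<Sum>B\<in>Pow (prime_factors n). 1 / sqrt (sqrt (real (\<Prod>B))))"
  proof (rule sum.cong)
    fix B :: "nat set"
    have "(\<Prod>p\<in>B. 1 / sqrt (sqrt (real p))) = 1 / sqrt (sqrt (real (\<Prod>B)))"
      by (induction B rule: infinite_finite_induct) (simp_all add: real_sqrt_mult)
    then show "(\<Prod>p\<in>B. 1 / sqrt (sqrt (real p))) * (\<Prod>p\<in>prime_factors n - B. 1) =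
        1 / sqrt (sqrt (real (\<Prod>B)))"
      by simp
  qed simp
  also have "\<dots> = (\<Sum>d | d dvd n \<and> squarefree d. 1 / sqrt (sqrt (real d)))"
    using assms by (rule sum_squarefree_divisors[symmetric])
  also have "\<dots> \<le> divisor_weight n"
    unfolding divisor_weight_def using assms by (intro sum_mono2) auto
  finally show ?thesis .
qed

text \<open>
  For \<open>t = p powr (1 / 4)\<close> the estimate without a constant reads
  \<open>1 \<le> (1 + 1 / t) * (1 - 1 / t\<^sup>2)\<close>, that is, \<open>t + 1 \<le> t\<^sup>2\<close>. This holds for \<open>t \<ge> 2\<close>; the finitely
  many primes below \<open>16\<close> receive the factor \<open>4\<close>.
\<close>

lemma euler_factor_le:
  assumes "prime p"
  shows "inverse (1 - 1 / sqrt (real p)) \<le> (if p < 16 then 4 else 1) * (1 + 1 / sqrt (sqrt (real p)))"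
proof (cases "p < 16")
  case True
  have "2 \<le> real p"
    using prime_ge_2_nat[OF assms] by simp
  then have "sqrt ((4 / 3)\<^sup>2) \<le> sqrt (real p)"
    by (intro real_sqrt_le_mono) (simp add: power2_eq_square)
  then have s: "4 / 3 \<le> sqrt (real p)"
    by simp
  then have "1 / sqrt (real p) \<le> 1 / (4 / 3)"
    using prime_gt_0_nat[OF assms] by (intro divide_left_mono) auto
  then have "inverse (1 - 1 / sqrt (real p)) \<le> inverse (1 / 4)"
    by (intro le_imp_inverse_le) auto
  also have "\<dots> \<le> 4 * (1 + 1 / sqrt (sqrt (real p)))"
    by simp
  finally show ?thesis
    using True by simp
next
  case False
  define t where "t = sqrt (sqrt (real p))"
  have "sqrt (sqrt (2 ^ 4)) \<le> t"
    unfolding t_def using False by (intro real_sqrt_le_mono) auto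
  moreover have "sqrt (sqrt (2 ^ 4)) = 2"
    by (simp add: real_sqrt_unique)
  ultimately have t: "2 \<le> t"
    by simp
  have tp: "sqrt (real p) = t * t"
    by (simp add: t_def)
  have t2: "2 * t \<le> t * t"
    using t by (intro mult_right_mono) auto
  have "1 \<le> (1 + 1 / t) * (1 - 1 / (t * t))"
  proof -
    have "(1 + 1 / t) * (1 - 1 / (t * t)) - 1 = (t * t - t - 1) / (t * t * t)"
      using t by (simp add: field_simps)
    also have "\<dots> \<ge> 0"
    proof (intro divide_nonneg_nonneg)
      show "0 \<le> t * t - t - 1"
        using t t2 by linarith
    qed (use t in auto)
    finally show ?thesis
      by simp
  qed
  moreover have "1 - 1 / (t * t) > 0"
  proof -
    have "1 < t * t"
      using t t2 by linarith
    then show ?thesis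
      by simp
  qed
  ultimately have "inverse (1 - 1 / (t * t)) \<le> 1 + 1 / t"
    by (simp add: inverse_eq_divide divide_le_eq)
  then show ?thesis
    unfolding tp[symmetric] using False by (simp add: t_def)
qed

lemma euler_product_le:
  assumes "a > 0" "b > 0"
  shows "(\<Prod>p\<in>prime_factors (a\<^sup>2 * b ^ 3). inverse (1 - 1 / sqrt (real p))) \<le>
    4 ^ 16 * (divisor_weight a * divisor_weight b)"
proof -
  let ?P = "prime_factors (a\<^sup>2 * b ^ 3)"
  let ?h = "\<lambda>p::nat. 1 + 1 / sqrt (sqrt (real p))"
  have P: "?P = prime_factors a \<union> (prime_factors b - prime_factors a)"
    using assms by (auto simp: in_prime_factors_iff prime_dvd_mult_iff prime_dvd_power_iff)
  have "(\<Prod>p\<in>?P. inverse (1 - 1 / sqrt (real p))) \<le> (\<Prod>p\<in>?P. (if p < 16 then 4 else 1) * ?h p)"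
  proof (intro prod_mono conjI)
    fix p assume "p \<in> ?P"
    then have p: "prime p"
      by (simp add: in_prime_factors_iff)
    show "inverse (1 - 1 / sqrt (real p)) \<le> (if p < 16 then 4 else 1) * ?h p"
      using p by (rule euler_factor_le)
    show "0 \<le> inverse (1 - 1 / sqrt (real p))"
      using prime_gt_1_nat[OF p] by simp
  qed
  also have "\<dots> = (\<Prod>p\<in>?P. if p < 16 then 4 else 1) * (\<Prod>p\<in>?P. ?h p)"
    by (rule prod.distrib)
  also have "\<dots> \<le> 4 ^ 16 * (divisor_weight a * divisor_weight b)"
  proof (rule mult_mono)
    have "(\<Prod>p\<in>?P. if p < 16 then 4 else 1) = (4::real) ^ card (?P \<inter> {p. p < 16})"
      by (simp add: prod.If_cases)
    also have "card (?P \<inter> {p. p < 16}) \<le> card {..<16::nat}"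
      by (intro card_mono) auto
    then have "(4::real) ^ card (?P \<inter> {p. p < 16}) \<le> 4 ^ 16"
      by (intro power_increasing) auto
    finally show "(\<Prod>p\<in>?P. if p < 16 then 4 else 1) \<le> (4::real) ^ 16" .
    have "(\<Prod>p\<in>?P. ?h p) = (\<Prod>p\<in>prime_factors a. ?h p) * (\<Prod>p\<in>prime_factors b - prime_factors a. ?h p)"
      unfolding P by (rule prod.union_disjoint) auto
    also have "\<dots> \<le> (\<Prod>p\<in>prime_factors a. ?h p) * (\<Prod>p\<in>prime_factors b. ?h p)"
      by (intro mult_left_mono prod_mono2 prod_nonneg) auto
    also have "\<dots> \<le> divisor_weight a * divisor_weight b"
      using assms
      by (intro mult_mono prod_le_divisor_weight divisor_weight_nonneg prod_nonneg) auto
    finally show "(\<Prod>p\<in>?P. ?h p) \<le> divisor_weight a * divisor_weight b" .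
  qed (auto intro!: prod_nonneg)
  finally show ?thesis .
qed

text \<open>
  Write \<open>n = d * k\<close> for each divisor \<open>d\<close> of \<open>n\<close>, and let \<open>d\<close> and \<open>k\<close> range independently.
\<close>

lemma sum_times_divisor_weight_le:
  fixes h :: "nat \<Rightarrow> real"
  assumes mult: "\<And>m n. h (m * n) = h m * h n" and nonneg: "\<And>n. 0 \<le> h n"
  shows "(\<Sum>n=1..N. h n * divisor_weight n) \<le> (\<Sum>d=1..N. h d / sqrt (sqrt (real d))) * (\<Sum>k=1..N. h k)"
proof -
  have "(\<Sum>n=1..N. h n * divisor_weight n) =
      (\<Sum>(n, d)\<in>(SIGMA n:{1..N}. {d. d dvd n}). h n * (1 / sqrt (sqrt (real d))))"
    unfolding divisor_weight_def sum_distrib_left by (rule sum.Sigma) auto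
  also have "\<dots> \<le> (\<Sum>(d, k)\<in>{1..N} \<times> {1..N}. h d / sqrt (sqrt (real d)) * h k)"
  proof (rule sum_le_included[where i = "\<lambda>(d, k). (d * k, d)"])
    show "finite (SIGMA n:{1..N}. {d. d dvd n})"
      by (intro finite_SigmaI) auto
    show "\<forall>y\<in>{1..N} \<times> {1..N}. 0 \<le> (case y of (d, k) \<Rightarrow> h d / sqrt (sqrt (real d)) * h k)"
      using nonneg by auto
    show "\<forall>x\<in>SIGMA n:{1..N}. {d. d dvd n}. \<exists>y\<in>{1..N} \<times> {1..N}.
        (case y of (d, k) \<Rightarrow> (d * k, d)) = x \<and>
        (case x of (n, d) \<Rightarrow> h n * (1 / sqrt (sqrt (real d)))) \<le>
        (case y of (d, k) \<Rightarrow> h d / sqrt (sqrt (real d)) * h k)"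
    proof
      fix x assume x: "x \<in> (SIGMA n:{1..N}. {d. d dvd n})"
      then obtain d k where dk: "x = (d * k, d)" "1 \<le> d * k" "d * k \<le> N"
        by (auto elim!: dvdE)
      then have pos: "d > 0" "k > 0"
        by (auto intro!: Nat.gr0I)
      moreover have "d \<le> N" "k \<le> N"
        using pos by (auto intro!: order_trans[OF _ dk(3)])
      ultimately have "(d, k) \<in> {1..N} \<times> {1..N}"
        by auto
      then show "\<exists>y\<in>{1..N} \<times> {1..N}.
        (case y of (d, k) \<Rightarrow> (d * k, d)) = x \<and>
        (case x of (n, d) \<Rightarrow> h n * (1 / sqrt (sqrt (real d)))) \<le>
        (case y of (d, k) \<Rightarrow> h d / sqrt (sqrt (real d)) * h k)"
        by (intro bexI[of _ "(d, k)"]) (simp_all add: dk mult)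
    qed
  qed simp
  also have "\<dots> = (\<Sum>d=1..N. h d / sqrt (sqrt (real d))) * (\<Sum>k=1..N. h k)"
    by (simp add: sum_product sum.cartesian_product)
  finally show ?thesis .
qed

lemma bounded_sum_5_4:
  "\<exists>K>0. \<forall>N. (\<Sum>n=1..N. 1 / (real n * sqrt (sqrt (real n)))) \<le> K"
proof -
  have conv: "1 / (real n * sqrt (sqrt (real n))) = real n powr (-5/4)" if "n > 0" for n
  proof -
    have "real n * sqrt (sqrt (real n)) = real n powr 1 * real n powr (1/4)"
      using that by (simp add: powr_half_sqrt[symmetric] powr_powr)
    also have "\<dots> = real n powr (5/4)"
      by (subst powr_add[symmetric]) simp
    finally show ?thesis
      by (simp add: powr_minus inverse_eq_divide)
  qed
  have sm: "summable (\<lambda>n. real n powr (-5/4))"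
    by (subst summable_real_powr_iff) simp
  define K where "K = (\<Sum>n. real n powr (-5/4))"
  have "(\<Sum>n=1..N. 1 / (real n * sqrt (sqrt (real n)))) \<le> K" for N
  proof -
    have "(\<Sum>n=1..N. 1 / (real n * sqrt (sqrt (real n)))) = (\<Sum>n=1..N. real n powr (-5/4))"
      using conv by (intro sum.cong) auto
    also have "\<dots> \<le> K"
      unfolding K_def by (rule sum_le_suminf[OF sm]) auto
    finally show ?thesis .
  qed
  then show ?thesis
    by (intro exI[of _ "max K 1"]) (auto intro: order_trans[OF _ max.cobounded1])
qed

lemma harmonic_sum_le:
  assumes "1 \<le> N"
  shows "(\<Sum>k=1..N. 1 / real k) \<le> 1 + ln (real N)"
  using assms
proof (induction N rule: dec_induct)
  case (step N)
  have "ln (real N / real (Suc N)) \<le> real N / real (Suc N) - 1"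
    using step by (intro ln_le_minus_one) simp
  also have "\<dots> = - (1 / real (Suc N))"
    by (simp add: field_simps)
  finally have "1 / real (Suc N) \<le> ln (real (Suc N)) - ln (real N)"
    using step by (simp add: ln_div)
  with step show ?case
    by simp
qed simp

text \<open>
  With \<open>f = a\<^sup>2 * b ^ 3\<close> the sum is dominated by a product of a sum over \<open>a\<close> with weight \<open>1 / a\<close> and
  a sum over \<open>b\<close> with weight \<open>b powr (- 3 / 2)\<close>, each also weighted by a divisor sum. The second
  is bounded. The first is at most a constant times the harmonic sum, and this is the origin of the
  logarithm in the error term.
\<close>

lemma sum_powerful_weight_le:
  "\<exists>C. \<forall>x F. 1 \<le> x \<longrightarrow> finite F \<longrightarrow> (\<forall>f\<in>F. powerful f \<and> real f \<le> x) \<longrightarrow>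
     (\<Sum>f\<in>F. 1 / sqrt (real f) * (\<Prod>p\<in>prime_factors f. inverse (1 - 1 / sqrt (real p)))) \<le> C * (1 + ln x)"
proof -
  obtain K where K: "K > 0" "\<And>N. (\<Sum>n=1..N. 1 / (real n * sqrt (sqrt (real n)))) \<le> K"
    using bounded_sum_5_4 by auto
  have bound: "(\<Sum>f\<in>F. 1 / sqrt (real f) * (\<Prod>p\<in>prime_factors f. inverse (1 - 1 / sqrt (real p))))
      \<le> 4 ^ 16 * K ^ 3 * (1 + ln x)"
    if x: "1 \<le> x" and F: "finite F" "\<And>f. f \<in> F \<Longrightarrow> powerful f" "\<And>f. f \<in> F \<Longrightarrow> real f \<le> x"
    for x F
  proof -
    define N where "N = nat \<lfloor>x\<rfloor>"
    have N: "1 \<le> N" "real N \<le> x"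
      using x by (auto simp: N_def le_nat_iff)
    have cube: "1 / (real n * sqrt (real n)) \<le> 1 / (real n * sqrt (sqrt (real n)))" if "n \<ge> 1" for n
    proof -
      have "1 \<le> sqrt (real n)"
        using that by simp
      then have "sqrt (sqrt (real n)) * 1 \<le> sqrt (sqrt (real n)) * sqrt (sqrt (real n))"
        by (intro mult_left_mono) auto
      then show ?thesis
        using that by (intro divide_left_mono mult_left_mono) auto
    qed
    have K2: "(\<Sum>n=1..N. 1 / (real n * sqrt (real n))) \<le> K"
      by (rule order_trans[OF sum_mono K(2)[of N]]) (use cube in auto)
    have K3: "(\<Sum>n=1..N. 1 / (real n * sqrt (real n)) / sqrt (sqrt (real n))) \<le> K"
    proof (rule order_trans[OF sum_mono K2])
      fix n assume "n \<in> {1..N}"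
      then have "1 \<le> sqrt (sqrt (real n))"
        by simp
      then show "1 / (real n * sqrt (real n)) / sqrt (sqrt (real n)) \<le> 1 / (real n * sqrt (real n))"
        using divide_left_mono[of 1 "sqrt (sqrt (real n))" "1 / (real n * sqrt (real n))"] by simp
    qed
    have A: "(\<Sum>a=1..N. 1 / real a * divisor_weight a) \<le> K * (1 + ln x)"
    proof -
      have "(\<Sum>a=1..N. 1 / real a * divisor_weight a)
          \<le> (\<Sum>d=1..N. 1 / real d / sqrt (sqrt (real d))) * (\<Sum>k=1..N. 1 / real k)"
        by (rule sum_times_divisor_weight_le) auto
      also have "\<dots> \<le> K * (1 + ln (real N))"
        using K harmonic_sum_le[OF N(1)] by (intro mult_mono sum_nonneg) auto
      also have "\<dots> \<le> K * (1 + ln x)"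
        using K(1) N x by (intro mult_left_mono add_left_mono ln_mono) auto
      finally show ?thesis .
    qed
    have B: "(\<Sum>b=1..N. 1 / (real b * sqrt (real b)) * divisor_weight b) \<le> K * K"
    proof -
      have "(\<Sum>b=1..N. 1 / (real b * sqrt (real b)) * divisor_weight b)
          \<le> (\<Sum>d=1..N. 1 / (real d * sqrt (real d)) / sqrt (sqrt (real d))) *
             (\<Sum>k=1..N. 1 / (real k * sqrt (real k)))"
        by (rule sum_times_divisor_weight_le) (auto simp: real_sqrt_mult)
      also have "\<dots> \<le> K * K"
        using K(1) K2 K3 by (intro mult_mono sum_nonneg) auto
      finally show ?thesis .
    qed
    let ?g = "\<lambda>(a, b). 4 ^ 16 * ((1 / real a * divisor_weight a) *
        (1 / (real b * sqrt (real b)) * divisor_weight b))"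
    have "(\<Sum>f\<in>F. 1 / sqrt (real f) * (\<Prod>p\<in>prime_factors f. inverse (1 - 1 / sqrt (real p))))
        \<le> (\<Sum>y\<in>{1..N} \<times> {1..N}. ?g y)"
    proof (rule sum_le_included[where i = "\<lambda>(a, b). a\<^sup>2 * b ^ 3"])
      show "\<forall>y\<in>{1..N} \<times> {1..N}. 0 \<le> ?g y"
        by (auto simp: divisor_weight_nonneg)
      show "\<forall>f\<in>F. \<exists>y\<in>{1..N} \<times> {1..N}. (case y of (a, b) \<Rightarrow> a\<^sup>2 * b ^ 3) = f \<and>
          1 / sqrt (real f) * (\<Prod>p\<in>prime_factors f. inverse (1 - 1 / sqrt (real p))) \<le> ?g y"
      proof
        fix f assume f: "f \<in> F"
        then obtain a b where ab: "0 < a" "0 < b" "f = a\<^sup>2 * b ^ 3"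
          using powerful_eq_square_times_cube F(2) by blast
        have "f \<le> N"
          using F(3)[OF f] x by (simp add: N_def le_nat_iff le_floor_iff)
        moreover have "a \<le> f" "b \<le> f"
          using ab by (auto intro!: dvd_imp_le)
        ultimately have "(a, b) \<in> {1..N} \<times> {1..N}"
          using ab by auto
        moreover have "1 / sqrt (real f) * (\<Prod>p\<in>prime_factors f. inverse (1 - 1 / sqrt (real p))) \<le> ?g (a, b)"
        proof -
          have "sqrt (real f) = real a * (real b * sqrt (real b))"
            by (simp add: ab(3) real_sqrt_mult power3_eq_cube)
          then have "?g (a, b) = 1 / sqrt (real f) * (4 ^ 16 * (divisor_weight a * divisor_weight b))"
            by simp
          then show ?thesis
            using euler_product_le[OF ab(1,2)] by (simp only: ab(3)) (intro mult_left_mono, auto)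
        qed
        ultimately show "\<exists>y\<in>{1..N} \<times> {1..N}. (case y of (a, b) \<Rightarrow> a\<^sup>2 * b ^ 3) = f \<and>
          1 / sqrt (real f) * (\<Prod>p\<in>prime_factors f. inverse (1 - 1 / sqrt (real p))) \<le> ?g y"
          using ab(3) by (intro bexI[of _ "(a, b)"]) simp_all
      qed
    qed (use F in auto)
    also have "\<dots> = 4 ^ 16 * ((\<Sum>a=1..N. 1 / real a * divisor_weight a) *
        (\<Sum>b=1..N. 1 / (real b * sqrt (real b)) * divisor_weight b))"
      by (subst sum_product, subst sum.cartesian_product, subst sum_distrib_left)
        (simp add: case_prod_unfold)
    also have "\<dots> \<le> 4 ^ 16 * ((K * (1 + ln x)) * (K * K))"
      using A B K(1) x
      by (intro mult_left_mono mult_mono sum_nonneg mult_nonneg_nonneg) (auto simp: divisor_weight_nonneg)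
    also have "\<dots> = 4 ^ 16 * K ^ 3 * (1 + ln x)"
      by (simp add: power3_eq_cube)
    finally show ?thesis .
  qed
  show ?thesis
    by (rule exI[of _ "4 ^ 16 * K ^ 3"]) (use bound in blast)
qed

text \<open>
  With \<open>f = a\<^sup>2 * b ^ 3\<close> and \<open>b\<close> fixed, \<open>a\<close> exceeds \<open>sqrt (x / b ^ 3)\<close>. The tail of the series of
  inverse squares then contributes \<open>2 * sqrt (b ^ 3 / x)\<close>, and the remaining series over \<open>b\<close> has
  the terms \<open>b powr (- 3 / 2)\<close>.
\<close>

lemma sum_powerful_tail_le:
  "\<exists>C>0. \<forall>x F. 0 < x \<longrightarrow> finite F \<longrightarrow> (\<forall>f\<in>F. powerful f \<and> x < real f) \<longrightarrow>
     (\<Sum>f\<in>F. 1 / real f) \<le> C / sqrt x"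
proof -
  obtain K where K: "K > 0" "\<And>N. (\<Sum>n=1..N. 1 / (real n * sqrt (sqrt (real n)))) \<le> K"
    using bounded_sum_5_4 by auto
  have bound: "(\<Sum>f\<in>F. 1 / real f) \<le> 2 * K / sqrt x"
    if x: "0 < x" and F: "finite F" "\<And>f. f \<in> F \<Longrightarrow> powerful f" "\<And>f. f \<in> F \<Longrightarrow> x < real f"
    for x F
  proof -
    define N where "N = Max (insert 1 F)"
    define A where "A = (\<lambda>b. {a\<in>{1..N}. x < real a ^ 2 * real b ^ 3})"
    have "(\<Sum>f\<in>F. 1 / real f) \<le> (\<Sum>(b, a)\<in>(SIGMA b:{1..N}. A b). 1 / real b ^ 3 * (1 / real a ^ 2))"
    proof (rule sum_le_included[where i = "\<lambda>(b, a). a\<^sup>2 * b ^ 3"])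
      show "\<forall>f\<in>F. \<exists>y\<in>(SIGMA b:{1..N}. A b). (case y of (b, a) \<Rightarrow> a\<^sup>2 * b ^ 3) = f \<and>
          1 / real f \<le> (case y of (b, a) \<Rightarrow> 1 / real b ^ 3 * (1 / real a ^ 2))"
      proof
        fix f assume f: "f \<in> F"
        then obtain a b where ab: "0 < a" "0 < b" "f = a\<^sup>2 * b ^ 3"
          using powerful_eq_square_times_cube F(2) by blast
        have "f \<le> N"
          using F(1) f by (simp add: N_def)
        moreover have "a \<le> f" "b \<le> f"
          using ab by (auto intro!: dvd_imp_le)
        ultimately have "(b, a) \<in> (SIGMA b:{1..N}. A b)"
          using ab F(3)[OF f] by (auto simp: A_def)
        then show "\<exists>y\<in>(SIGMA b:{1..N}. A b). (case y of (b, a) \<Rightarrow> a\<^sup>2 * b ^ 3) = f \<and>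
          1 / real f \<le> (case y of (b, a) \<Rightarrow> 1 / real b ^ 3 * (1 / real a ^ 2))"
          using ab(3) by (intro bexI[of _ "(b, a)"]) (simp_all add: mult.commute)
      qed
    qed (use F in \<open>auto simp: A_def\<close>)
    also have "\<dots> = (\<Sum>b=1..N. 1 / real b ^ 3 * (\<Sum>a\<in>A b. 1 / real a ^ 2))"
      unfolding sum_distrib_left by (rule sum.Sigma[symmetric]) (auto simp: A_def)
    also have "\<dots> \<le> (\<Sum>b=1..N. 2 / sqrt x * (1 / (real b * sqrt (sqrt (real b)))))"
    proof (rule sum_mono)
      fix b assume b: "b \<in> {1..N}"
      define u where "u = sqrt (real b)"
      have u: "1 \<le> u" "real b = u\<^sup>2"
        using b by (auto simp: u_def)
      have "(\<Sum>a\<in>A b. 1 / real a ^ 2) \<le> 2 / (sqrt x / u ^ 3)"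
      proof (rule sum_inverse_squares_tail_le)
        fix a assume "a \<in> A b"
        then have "x < (real a * u ^ 3) ^ 2"
          by (simp add: A_def u(2) power_mult_distrib flip: power_mult)
        then have "sqrt x < real a * u ^ 3"
          using u x by (intro real_less_lsqrt) auto
        then show "sqrt x / u ^ 3 < real a"
          using u by (simp add: divide_less_eq)
      qed (use x u in \<open>auto simp: A_def\<close>)
      then have "1 / real b ^ 3 * (\<Sum>a\<in>A b. 1 / real a ^ 2) \<le> 1 / real b ^ 3 * (2 / (sqrt x / u ^ 3))"
        by (intro mult_left_mono) auto
      also have "\<dots> = 2 / sqrt x * (1 / (real b * u))"
        using u(1) by (simp add: u(2) field_simps eval_nat_numeral)
      also have "\<dots> \<le> 2 / sqrt x * (1 / (real b * sqrt u))"
      proof -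
        have "sqrt u * 1 \<le> sqrt u * sqrt u"
          using u by (intro mult_left_mono) auto
        then have "sqrt u \<le> u"
          using u by simp
        then show ?thesis
          using u b x by (intro mult_left_mono divide_left_mono) auto
      qed
      finally show "1 / real b ^ 3 * (\<Sum>a\<in>A b. 1 / real a ^ 2) \<le>
          2 / sqrt x * (1 / (real b * sqrt (sqrt (real b))))"
        by (simp add: u_def)
    qed
    also have "\<dots> = 2 / sqrt x * (\<Sum>b=1..N. 1 / (real b * sqrt (sqrt (real b))))"
      by (simp add: sum_distrib_left)
    also have "\<dots> \<le> 2 / sqrt x * K"
      using K(2) x by (intro mult_left_mono) auto
    finally show ?thesis
      by simp
  qed
  show ?thesis
    by (rule exI[of _ "2 * K"]) (use bound K(1) in auto)
qed

section \<open>The factorization into a powerful and a squarefree part\<close>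

definition simple_part :: "nat \<Rightarrow> nat" where
  "simple_part n = \<Prod>{p \<in> prime_factors n. multiplicity p n = 1}"

lemma squarefree_simple_part: "squarefree (simple_part n)"
  unfolding simple_part_def by (rule squarefree_prod_primes) (auto simp: in_prime_factors_iff)

lemma multiplicity_simple_part:
  assumes "prime p"
  shows "multiplicity p (simple_part n) = (if multiplicity p n = 1 then 1 else 0)"
proof -
  define B where "B = {p \<in> prime_factors n. multiplicity p n = 1}"
  have "finite B" "\<And>q. q \<in> B \<Longrightarrow> prime q"
    by (auto simp: B_def)
  from multiplicity_prod_prime_powers[OF this assms, of "\<lambda>_. 1"]
  have "multiplicity p (simple_part n) = (if p \<in> B then 1 else 0)"
    by (simp add: simple_part_def B_def)
  also have "p \<in> B \<longleftrightarrow> multiplicity p n = 1"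
    using assms by (auto simp: B_def prime_factors_multiplicity)
  finally show ?thesis .
qed

lemma simple_part_dvd:
  assumes "n > 0"
  shows "simple_part n dvd n"
proof (rule multiplicity_le_imp_dvd)
  show "simple_part n \<noteq> 0"
    using squarefree_simple_part[of n] by (intro notI) simp
qed (use assms in \<open>auto simp: multiplicity_simple_part\<close>)

lemma multiplicity_powerful_times_squarefree:
  assumes "powerful f" "squarefree s" "\<And>p. p \<in> prime_factors f \<Longrightarrow> \<not> p dvd s" "prime p"
  shows "multiplicity p (f * s) = (if p dvd s then 1 else multiplicity p f)"
    and "p dvd s \<Longrightarrow> multiplicity p f = 0"
    and "multiplicity p f \<noteq> 1"
proof -
  have f0: "f \<noteq> 0"
    using assms(1) by (simp add: powerful_def)
  have s0: "s \<noteq> 0"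
    using assms(2) by (intro notI) simp
  show f: "multiplicity p f = 0" if "p dvd s"
    using assms(3,4) that f0 by (intro not_dvd_imp_multiplicity_0) (auto simp: in_prime_factors_iff)
  show "multiplicity p f \<noteq> 1"
    using assms(1,4) by (auto simp: powerful_def prime_factors_multiplicity)
  have s: "multiplicity p s = (if p dvd s then 1 else 0)"
    using assms(2,4) by (rule multiplicity_squarefree)
  show "multiplicity p (f * s) = (if p dvd s then 1 else multiplicity p f)"
    using assms(4) f0 s0 s f by (auto simp: prime_elem_multiplicity_mult_distrib)
qed

lemma simple_part_powerful_times_squarefree:
  assumes "powerful f" "squarefree s" "\<And>p. p \<in> prime_factors f \<Longrightarrow> \<not> p dvd s"
  shows "simple_part (f * s) = s"
proof (rule multiplicity_eq_nat)
  show "0 < simple_part (f * s)"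
    using squarefree_simple_part[of "f * s"] by (intro Nat.gr0I) simp
  show "0 < s"
    using assms(2) by (intro Nat.gr0I) simp
  fix p :: nat assume p: "prime p"
  have "multiplicity p s = (if p dvd s then 1 else 0)"
    using assms(2) p by (rule multiplicity_squarefree)
  then show "multiplicity p (simple_part (f * s)) = multiplicity p s"
    using multiplicity_powerful_times_squarefree[OF assms p] p
    by (simp add: multiplicity_simple_part)
qed

lemma powerful_div_simple_part:
  assumes "n > 0"
  shows "powerful (n div simple_part n)"
    and "\<And>p. p \<in> prime_factors (n div simple_part n) \<Longrightarrow> \<not> p dvd simple_part n"
proof -
  define f where "f = n div simple_part n"
  have n: "n = f * simple_part n"
    using simple_part_dvd[OF assms] by (simp add: f_def)
  have s0: "simple_part n \<noteq> 0"
    using squarefree_simple_part[of n] by (intro notI) simp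
  have f0: "f \<noteq> 0"
    using n assms by (intro notI) simp
  have mult: "multiplicity p n = multiplicity p f + (if multiplicity p n = 1 then 1 else 0)"
    if "prime p" for p
  proof -
    have "multiplicity p n = multiplicity p f + multiplicity p (simple_part n)"
      using prime_elem_multiplicity_mult_distrib[of p f "simple_part n"] that f0 s0 n by simp
    then show ?thesis
      using that by (simp only: multiplicity_simple_part)
  qed
  have "2 \<le> multiplicity p f \<and> \<not> p dvd simple_part n" if p: "p \<in> prime_factors f" for p
  proof -
    have "prime p" "multiplicity p f > 0"
      using p by (auto simp: prime_factors_multiplicity)
    moreover from this have "multiplicity p n \<noteq> 1"
      using mult[of p] by auto
    ultimately have "2 \<le> multiplicity p f" "multiplicity p (simple_part n) = 0"
      using mult[of p] by (auto simp: multiplicity_simple_part)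
    then show ?thesis
      using \<open>prime p\<close> s0 by (metis not_dvd_imp_multiplicity_0 multiplicity_eq_zero_iff not_prime_unit)
  qed
  then show "powerful (n div simple_part n)"
    "\<And>p. p \<in> prime_factors (n div simple_part n) \<Longrightarrow> \<not> p dvd simple_part n"
    using f0 by (auto simp: powerful_def f_def[symmetric])
qed

text \<open>
  The factor \<open>s\<close> affects only the number of primes of multiplicity one, whose coefficient vanishes.
\<close>

lemma omega_seq_powerful_times_squarefree:
  assumes "A 1 = 0" "powerful f" "squarefree s" "\<And>p. p \<in> prime_factors f \<Longrightarrow> \<not> p dvd s"
  shows "omega_seq A (f * s) = omega_seq A f"
  unfolding omega_seq_def
proof (rule infsum_cong)
  fix j :: nat assume j: "j \<in> {1..}"
  show "A j * of_nat (omega_mult j (f * s)) = A j * of_nat (omega_mult j f)"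
  proof (cases "j = 1")
    case True
    with assms(1) show ?thesis
      by simp
  next
    case False
    have "multiplicity p (f * s) = j \<longleftrightarrow> multiplicity p f = j" if "prime p" for p
      using multiplicity_powerful_times_squarefree[OF assms(2-4) that] j False by auto
    then have "{p. prime p \<and> multiplicity p (f * s) = j} = {p. prime p \<and> multiplicity p f = j}"
      by blast
    then show ?thesis
      by (simp add: omega_mult_def)
  qed
qed

text \<open>
  Every positive \<open>n\<close> is uniquely \<open>f * s\<close> with \<open>f\<close> powerful and \<open>s\<close> squarefree and coprime to
  \<open>f\<close>, where \<open>s\<close> is necessarily \<open>simple_part n\<close>.
\<close>

lemma card_level_set_eq_sum:
  assumes "A 1 = 0"
  shows "card (level_set A m x) =
    (\<Sum>f | powerful f \<and> omega_seq A f = m \<and> real f \<le> x.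
       card (squarefree_avoiding (prime_factors f) (x / real f)))"
proof -
  let ?F = "{f. powerful f \<and> omega_seq A f = m \<and> real f \<le> x}"
  let ?S = "\<lambda>f. squarefree_avoiding (prime_factors f) (x / real f)"
  have fin: "finite ?F"
    by (rule finite_subset[of _ "{..nat \<lfloor>x\<rfloor>}"]) (auto simp: le_nat_floor)
  have "bij_betw (\<lambda>(f, s). f * s) (SIGMA f:?F. ?S f) (level_set A m x)"
  proof (rule bij_betw_byWitness[where f' = "\<lambda>n. (n div simple_part n, simple_part n)"])
    show "\<forall>y\<in>SIGMA f:?F. ?S f.
        (\<lambda>n. (n div simple_part n, simple_part n)) ((\<lambda>(f, s). f * s) y) = y"
    proof
      fix y assume "y \<in> (SIGMA f:?F. ?S f)"
      then obtain f s where y: "y = (f, s)" "powerful f" "squarefree s" "s > 0"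
          "\<And>p. p \<in> prime_factors f \<Longrightarrow> \<not> p dvd s"
        by (auto simp: squarefree_avoiding_def)
      have "simple_part (f * s) = s"
        by (rule simple_part_powerful_times_squarefree[OF y(2,3,5)])
      then show "(\<lambda>n. (n div simple_part n, simple_part n)) ((\<lambda>(f, s). f * s) y) = y"
        using y(1,4) by simp
    qed
    show "\<forall>n\<in>level_set A m x.
        (\<lambda>(f, s). f * s) (n div simple_part n, simple_part n) = n"
      by (auto simp: level_set_def simple_part_dvd)
    show "(\<lambda>(f, s). f * s) ` (SIGMA f:?F. ?S f) \<subseteq> level_set A m x"
    proof
      fix n assume "n \<in> (\<lambda>(f, s). f * s) ` (SIGMA f:?F. ?S f)"
      then obtain f s where fs: "n = f * s" "powerful f" "omega_seq A f = m" "squarefree s" "s > 0"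
          "\<And>p. p \<in> prime_factors f \<Longrightarrow> \<not> p dvd s" "real s \<le> x / real f"
        by (auto simp: squarefree_avoiding_def)
      have "f > 0"
        using fs(2) by (simp add: powerful_def)
      then show "n \<in> level_set A m x"
        using omega_seq_powerful_times_squarefree[where A = A, OF assms fs(2,4,6)] fs(1,3,5,7)
        by (simp add: level_set_def field_simps)
    qed
    show "(\<lambda>n. (n div simple_part n, simple_part n)) ` level_set A m x \<subseteq> (SIGMA f:?F. ?S f)"
    proof
      fix y assume "y \<in> (\<lambda>n. (n div simple_part n, simple_part n)) ` level_set A m x"
      then obtain n where n: "y = (n div simple_part n, simple_part n)" "n > 0" "real n \<le> x"
          "omega_seq A n = m"
        by (auto simp: level_set_def)
      define f where "f = n div simple_part n"
      define s where "s = simple_part n"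
      have nfs: "n = f * s"
        using simple_part_dvd[OF n(2)] by (simp add: f_def s_def)
      have f: "powerful f" "\<And>p. p \<in> prime_factors f \<Longrightarrow> \<not> p dvd s"
        using powerful_div_simple_part[OF n(2)] by (auto simp: f_def s_def)
      have s: "squarefree s"
        by (simp add: s_def squarefree_simple_part)
      have pos: "f > 0" "s > 0"
        using n(2) nfs by auto
      have "f \<le> n"
        using pos nfs by simp
      then have "real f \<le> x"
        using n(3) by linarith
      moreover have "omega_seq A f = m"
        using omega_seq_powerful_times_squarefree[where A = A, OF assms f(1) s f(2)] n(4) nfs by simp
      moreover have "real s \<le> x / real f"
        using n(3) pos by (simp add: nfs field_simps)
      ultimately have "(f, s) \<in> (SIGMA f:?F. ?S f)"
        using f s pos by (simp add: squarefree_avoiding_def)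
      then show "y \<in> (SIGMA f:?F. ?S f)"
        by (simp add: n(1) f_def s_def)
    qed
  qed
  then have "card (level_set A m x) = card (SIGMA f:?F. ?S f)"
    by (rule bij_betw_same_card[symmetric])
  also have "\<dots> = (\<Sum>f\<in>?F. card (?S f))"
    using fin by (intro card_SigmaI) (auto simp: finite_squarefree_avoiding)
  finally show ?thesis .
qed

section \<open>The density of the level sets\<close>

lemma summable_on_powerful_reciprocals: "(\<lambda>f. 1 / real f) summable_on {f. powerful f}"
proof (rule nonneg_bdd_above_summable_on)
  obtain C where C: "\<And>x F. 0 < x \<Longrightarrow> finite F \<Longrightarrow> \<forall>f\<in>F. powerful f \<and> x < real f \<Longrightarrow>
      (\<Sum>f\<in>F. 1 / real f) \<le> C / sqrt x"
    using sum_powerful_tail_le by blast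
  show "bdd_above (sum (\<lambda>f. 1 / real f) ` {F. F \<subseteq> {f. powerful f} \<and> finite F})"
  proof (rule bdd_aboveI2)
    fix F :: "nat set" assume F: "F \<in> {F. F \<subseteq> {f. powerful f} \<and> finite F}"
    \<comment> \<open>All positive integers exceed \<open>1 / 2\<close>, so the tail bound applies to every finite set.\<close>
    show "sum (\<lambda>f. 1 / real f) F \<le> C / sqrt (1 / 2)"
    proof (rule C)
      show "\<forall>f\<in>F. powerful f \<and> 1 / 2 < real f"
        using F by (force simp: powerful_def)
    qed (use F in auto)
  qed
qed simp

lemma density_term_bounds:
  fixes f :: nat
  shows "0 \<le> 1 / real f * (\<Prod>p\<in>prime_factors f. inverse (1 + 1 / real p))"
    and "1 / real f * (\<Prod>p\<in>prime_factors f. inverse (1 + 1 / real p)) \<le> 1 / real f"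
proof -
  have "0 \<le> (\<Prod>p\<in>prime_factors f. inverse (1 + 1 / real p))"
    by (intro prod_nonneg) auto
  moreover have "(\<Prod>p\<in>prime_factors f. inverse (1 + 1 / real p)) \<le> 1"
    by (intro prod_le_1) (auto simp: inverse_le_1_iff)
  ultimately show "0 \<le> 1 / real f * (\<Prod>p\<in>prime_factors f. inverse (1 + 1 / real p))"
    "1 / real f * (\<Prod>p\<in>prime_factors f. inverse (1 + 1 / real p)) \<le> 1 / real f"
    by (intro mult_nonneg_nonneg mult_left_le; simp)+
qed

text \<open>
  There are two sources of error: the local errors of the squarefree counts for \<open>f \<le> x\<close>, and the
  terms with \<open>f > x\<close>, which are present in the infinite series but not in the count.
\<close>

lemma level_set_density_error:
  "\<exists>C. \<forall>A m x. A 1 = 0 \<longrightarrow> 2 \<le> x \<longrightarrow>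
     \<bar>real (card (level_set A m x)) - 6 / pi\<^sup>2 *
        (\<Sum>\<^sub>\<infinity>f\<in>{f. powerful f \<and> omega_seq A f = m}.
           1 / real f * (\<Prod>p\<in>prime_factors f. inverse (1 + 1 / real p))) * x\<bar>
     \<le> C * x powr (1 / 2) * ln x"
proof -
  obtain C1 where C1: "\<And>x F. 1 \<le> x \<Longrightarrow> finite F \<Longrightarrow> \<forall>f\<in>F. powerful f \<and> real f \<le> x \<Longrightarrow>
      (\<Sum>f\<in>F. 1 / sqrt (real f) * (\<Prod>p\<in>prime_factors f. inverse (1 - 1 / sqrt (real p)))) \<le> C1 * (1 + ln x)"
    using sum_powerful_weight_le by blast
  obtain C2 where C2: "C2 > 0" "\<And>x F. 0 < x \<Longrightarrow> finite F \<Longrightarrow> \<forall>f\<in>F. powerful f \<and> x < real f \<Longrightarrow>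
      (\<Sum>f\<in>F. 1 / real f) \<le> C2 / sqrt x"
    using sum_powerful_tail_le by blast
  have C1_nonneg: "0 \<le> C1"
    using C1[of 1 "{}"] by simp
  define g where "g = (\<lambda>f. 1 / real f * (\<Prod>p\<in>prime_factors f. inverse (1 + 1 / real p)))"
  define G where "G = (\<lambda>f. \<Prod>p\<in>prime_factors f. inverse (1 - 1 / sqrt (real p)))"
  have g: "0 \<le> g f" "g f \<le> 1 / real f" for f
    unfolding g_def by (rule density_term_bounds)+
  have main: "\<bar>real (card (level_set A m x)) - 6 / pi\<^sup>2 * (\<Sum>\<^sub>\<infinity>f\<in>{f. powerful f \<and> omega_seq A f = m}. g f) * x\<bar>
     \<le> (3 * C1 + C2) * sqrt x * (1 + ln x)"
    if A: "A 1 = 0" and x: "2 \<le> x" for A m x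
  proof -
    define F where "F = {f. powerful f \<and> omega_seq A f = m \<and> real f \<le> x}"
    define T where "T = {f. powerful f \<and> omega_seq A f = m \<and> x < real f}"
    have fin: "finite F"
      unfolding F_def by (rule finite_subset[of _ "{..nat \<lfloor>x\<rfloor>}"]) (auto simp: le_nat_floor)
    have summable: "g summable_on B" if "B \<subseteq> {f. powerful f}" for B
    proof (rule summable_on_comparison_test)
      show "(\<lambda>f. 1 / real f) summable_on B"
        using summable_on_powerful_reciprocals that by (rule summable_on_subset_banach)
    qed (use g in auto)
    have "infsum g {f. powerful f \<and> omega_seq A f = m} = infsum g (F \<union> T)"
      by (intro arg_cong2[where f = infsum]) (auto simp: F_def T_def)
    also have "\<dots> = infsum g F + infsum g T"
      by (intro infsum_Un_disjoint summable) (auto simp: F_def T_def)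
    finally have split: "infsum g {f. powerful f \<and> omega_seq A f = m} = sum g F + infsum g T"
      using fin by simp
    have tail: "infsum g T \<le> C2 / sqrt x"
    proof (rule infsum_le_finite_sums)
      show "g summable_on T"
        by (rule summable) (auto simp: T_def)
      fix B assume B: "finite B" "B \<subseteq> T"
      have "sum g B \<le> (\<Sum>f\<in>B. 1 / real f)"
        using g by (intro sum_mono) auto
      also have "\<dots> \<le> C2 / sqrt x"
        using B x by (intro C2) (auto simp: T_def)
      finally show "sum g B \<le> C2 / sqrt x" .
    qed
    have tail0: "0 \<le> infsum g T"
      using g by (intro infsum_nonneg) auto
    have local_err: "\<bar>real (card (squarefree_avoiding (prime_factors f) (x / real f))) - 6 / pi\<^sup>2 * g f * x\<bar>
        \<le> 3 * sqrt x * (1 / sqrt (real f) * G f)" if "f \<in> F" for f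
    proof -
      have "f > 0"
        using that by (simp add: F_def powerful_def)
      have "\<bar>real (card (squarefree_avoiding (prime_factors f) (x / real f))) -
          6 / pi\<^sup>2 * (\<Prod>p\<in>prime_factors f. inverse (1 + 1 / real p)) * (x / real f)\<bar>
          \<le> 3 * sqrt (x / real f) * G f"
        unfolding G_def using \<open>f > 0\<close> x
        by (intro squarefree_avoiding_error) (auto simp: in_prime_factors_iff)
      then show ?thesis
        by (simp add: g_def real_sqrt_divide mult_ac)
    qed
    have "\<bar>real (card (level_set A m x)) - 6 / pi\<^sup>2 * sum g F * x\<bar> =
        \<bar>\<Sum>f\<in>F. real (card (squarefree_avoiding (prime_factors f) (x / real f))) - 6 / pi\<^sup>2 * g f * x\<bar>"
      unfolding card_level_set_eq_sum[of A m x, OF A] F_def[symmetric]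
      by (simp only: of_nat_sum sum_subtractf sum_distrib_left sum_distrib_right)
    also have "\<dots> \<le> (\<Sum>f\<in>F. 3 * sqrt x * (1 / sqrt (real f) * G f))"
      by (rule order_trans[OF sum_abs sum_mono]) (rule local_err)
    also have "\<dots> = 3 * sqrt x * (\<Sum>f\<in>F. 1 / sqrt (real f) * G f)"
      by (simp only: sum_distrib_left)
    also have "\<dots> \<le> 3 * sqrt x * (C1 * (1 + ln x))"
      unfolding G_def using x fin by (intro mult_left_mono C1) (auto simp: F_def)
    finally have E1: "\<bar>real (card (level_set A m x)) - 6 / pi\<^sup>2 * sum g F * x\<bar> \<le> 3 * sqrt x * (C1 * (1 + ln x))" .
    have "6 / pi\<^sup>2 * infsum g T * x \<le> 1 * (C2 / sqrt x) * x"
    proof (intro mult_right_mono mult_mono)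
      show "6 / pi\<^sup>2 \<le> 1"
        by (rule six_over_pi_squared_le_1)
    qed (use tail tail0 x C2(1) in auto)
    also have "\<dots> = C2 * sqrt x * 1"
      using x by (simp add: field_simps)
    also have "\<dots> \<le> C2 * sqrt x * (1 + ln x)"
      using x C2(1) by (intro mult_left_mono) auto
    finally have "\<bar>6 / pi\<^sup>2 * infsum g T * x\<bar> \<le> C2 * sqrt x * (1 + ln x)"
      using tail0 x by simp
    moreover have "6 / pi\<^sup>2 * (sum g F + infsum g T) * x = 6 / pi\<^sup>2 * sum g F * x + 6 / pi\<^sup>2 * infsum g T * x"
      by (simp only: distrib_left distrib_right)
    moreover have "(3 * C1 + C2) * sqrt x * (1 + ln x) =
        3 * sqrt x * (C1 * (1 + ln x)) + C2 * sqrt x * (1 + ln x)"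
      by (simp add: algebra_simps)
    ultimately show ?thesis
      using E1 unfolding split by linarith
  qed
  have "\<bar>real (card (level_set A m x)) - 6 / pi\<^sup>2 * (\<Sum>\<^sub>\<infinity>f\<in>{f. powerful f \<and> omega_seq A f = m}. g f) * x\<bar>
     \<le> (3 * C1 + C2) * (1 / ln 2 + 1) * x powr (1 / 2) * ln x"
    if A: "A 1 = 0" and x: "2 \<le> x" for A m x
  proof -
    have "ln 2 \<le> ln x"
      using x by simp
    \<comment> \<open>Since \<open>x \<ge> 2\<close>, the summand \<open>1\<close> is at most \<open>ln x / ln 2\<close>.\<close>
    then have "1 + ln x \<le> (1 / ln 2 + 1) * ln x"
      by (simp add: field_simps)
    then have "(3 * C1 + C2) * sqrt x * (1 + ln x) \<le> (3 * C1 + C2) * sqrt x * ((1 / ln 2 + 1) * ln x)"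
      using x C1_nonneg C2(1) by (intro mult_left_mono) auto
    also have "\<dots> = (3 * C1 + C2) * (1 / ln 2 + 1) * x powr (1 / 2) * ln x"
      using x by (simp add: powr_half_sqrt)
    finally show ?thesis
      using main[of A x m, OF A x] by linarith
  qed
  then show ?thesis
    unfolding g_def by blast
qed

theorem theorem9:
  shows "(\<forall>(A :: nat \<Rightarrow> complex) (m :: complex). A 1 = 0 \<longrightarrow>
            ((\<lambda>x::real. real (card (level_set A m x)) / x) \<longlongrightarrow> level_density A m) at_top \<and>
            (\<lambda>f. 1 / real f * (\<Prod>p\<in>prime_factors f. inverse (1 + 1 / real p)))
              summable_on {f. powerful f \<and> omega_seq A f = m} \<and>
            level_density A m =
              6 / pi\<^sup>2 * (\<Sum>\<^sub>\<infinity>f\<in>{f. powerful f \<and> omega_seq A f = m}.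
                1 / real f * (\<Prod>p\<in>prime_factors f. inverse (1 + 1 / real p)))) \<and>
         (\<exists>C::real. \<forall>(A :: nat \<Rightarrow> complex) (m :: complex) (x::real). A 1 = 0 \<longrightarrow> 2 \<le> x \<longrightarrow>
            \<bar>real (card (level_set A m x)) - level_density A m * x\<bar> \<le> C * x powr (1 / 2) * ln x)"
proof -
  define g where "g = (\<lambda>f. 1 / real f * (\<Prod>p\<in>prime_factors f. inverse (1 + 1 / real p)))"
  define e where "e = (\<lambda>A m. 6 / pi\<^sup>2 * (\<Sum>\<^sub>\<infinity>f\<in>{f. powerful f \<and> omega_seq A f = m}. g f))"
  obtain C where C: "\<And>A m x. A 1 = 0 \<Longrightarrow> 2 \<le> x \<Longrightarrow>
      \<bar>real (card (level_set A m x)) - e A m * x\<bar> \<le> C * x powr (1 / 2) * ln x"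
    using level_set_density_error unfolding e_def g_def by blast
  have lim: "((\<lambda>x. real (card (level_set A m x)) / x) \<longlongrightarrow> e A m) at_top"
    if A: "A 1 = 0" for A m
  proof (rule Lim_transform_bound[where g = "\<lambda>x. C * x powr (1 / 2) * ln x / x", THEN LIM_zero_cancel])
    show "((\<lambda>x::real. C * x powr (1 / 2) * ln x / x) \<longlongrightarrow> 0) at_top"
      by real_asymp
    show "\<forall>\<^sub>F x in at_top. norm (real (card (level_set A m x)) / x - e A m)
        \<le> norm (C * x powr (1 / 2) * ln x / x)"
      using eventually_ge_at_top[of 2]
    proof eventually_elim
      case (elim x)
      have "real (card (level_set A m x)) / x - e A m = (real (card (level_set A m x)) - e A m * x) / x"
        using elim by (simp add: field_simps)
      then have "norm (real (card (level_set A m x)) / x - e A m)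
          = \<bar>real (card (level_set A m x)) - e A m * x\<bar> / x"
        using elim by simp
      also have "\<dots> \<le> C * x powr (1 / 2) * ln x / x"
        using C[of A x m, OF A elim] elim by (intro divide_right_mono) auto
      finally show ?case
        unfolding real_norm_def by linarith
    qed
  qed
  have dens: "level_density A m = e A m" if "A 1 = 0" for A m
    unfolding level_density_def using lim[of A m, OF that] by (intro tendsto_Lim) auto
  have summable: "g summable_on {f. powerful f \<and> omega_seq A f = m}" for A m
  proof (rule summable_on_comparison_test)
    show "(\<lambda>f. 1 / real f) summable_on {f. powerful f \<and> omega_seq A f = m}"
      using summable_on_powerful_reciprocals by (rule summable_on_subset_banach) auto
    show "0 \<le> g f" "g f \<le> 1 / real f" for f
      unfolding g_def by (rule density_term_bounds)+
  qed
  show ?thesis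
    unfolding g_def[symmetric]
  proof (intro conjI allI impI exI)
    fix A :: "nat \<Rightarrow> complex" and m :: complex
    assume A: "A 1 = 0"
    show "((\<lambda>x::real. real (card (level_set A m x)) / x) \<longlongrightarrow> level_density A m) at_top"
      using lim[of A m, OF A] by (simp only: dens[of A m, OF A])
    show "g summable_on {f. powerful f \<and> omega_seq A f = m}"
      by (rule summable)
    show "level_density A m = 6 / pi\<^sup>2 * infsum g {f. powerful f \<and> omega_seq A f = m}"
      using dens[of A m, OF A] by (simp only: e_def)
    fix x :: real
    assume x: "2 \<le> x"
    show "\<bar>real (card (level_set A m x)) - level_density A m * x\<bar> \<le> C * x powr (1 / 2) * ln x"
      using C[of A x m, OF A x] by (simp only: dens[of A m, OF A])
  qed
qed

end
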